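(* Let $P_0,P_1,\ldots$ give an iterative operadic theory of $n$-categories, with associated globular operads $Q^{(n)}\Rightarrow T^{(n)}$ (see context). For all $n>0$, an element ($m$-cell) of $Q^{(n)}(1)$ lying over a tree $\alpha\in T^{(n)}(1)$ consists of a label for each node of the tree, where, given $k\ge0$ and $0\le b<m\le n$, the label of a node of arity $k$ at height $b$ in an $m$-stage tree must be an $(m-b-1)$-cell of $P_{n-b-1}(k)$. The source (respectively target) of this element is found by 1. forgetting the top level of the tree and the top level of labels, and 2. replacing each remaining label with its source (respectively target).
   Context: **Operads and $(\mathcal V,P)$-categories.** "Operad" in a category $\mathcal V$ with finite products means a classical non-symmetric operad: objects $P(k)$ ($k\ge 0$), a unit $1\to P(1)$ and composition maps $P(m)\times P(k_1)\times\cdots\times P(k_m)\to P(k_1+\cdots+k_m)$, associative and unital. A $\mathcal V$-graph $A$ is a set $A_0$ of objects with an object $A(a,a')\in\mathcal V$ for all $a,a'\in A_0$; morphisms are functions on objects with morphisms $A(a,a')\to B(Fa,Fa')$. They form $\mathcal V\text{-}\mathbf{Gph}$. A $(\mathcal V,P)$-category is a $\mathcal V$-graph $A$ with, for all $k\ge0$ and $a_0,\dots,a_k\in A_0$, a morphism $\gamma: P(k)\times A(a_{k-1},a_k)\times\cdots\times A(a_0,a_1)\to A(a_0,a_k)$ (for $k=0$: $P(0)\to A(a,a)$), compatible with the operad structure: the unit of $P$ acts as the identity, and, for a composable string cut into $m$ consecutive blocks, applying $p_i\in P(k_i)$ to the $i$-th block along the string and then $p\in P(m)$ to the results agrees with applying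 the operadic composite $p(p_1,\dots,p_m)$ to the whole string. Morphisms are $\mathcal V$-graph morphisms commuting with all $\gamma$; the category is $(\mathcal V,P)\text{-}\mathbf{Cat}$. **Iterative operadic theory of $n$-categories.** For all $n\ge0$ a category $\mathcal V_n$ and a contractible operad $P_n$ in $\mathcal V_n$ such that $\mathcal V_0=\mathbf{Set}$ and $\mathcal V_{n+1}=(\mathcal V_n,P_n)\text{-}\mathbf{Cat}$. Contractibility: a set is contractible iff it has exactly one element; an operad is contractible if each $P(k)$ is; a $\mathcal V$-graph $A$ is contractible if $A_0\ne\emptyset$ and every $A(a,a')$ is contractible in $\mathcal V$; a $(\mathcal V,P)$-category is contractible if its underlying $\mathcal V$-graph is. **Globular sets and cells.** $n\text{-}\mathbf{GSet}$ is the category of $n$-globular sets (sets $A_0,\dots,A_n$ with $s,t:A_m\to A_{m-1}$, $ss=st$, $ts=tt$). It is identified with $n\text{-}\mathbf{Gph}$, where $0\text{-}\mathbf{Gph}=\mathbf{Set}$, $n\text{-}\mathbf{Gph}=((n-1)\text{-}\mathbf{Gph})\text{-}\mathbf{Gph}$: the 0-cells are the objects, the $m$-cells ($m\geq 1$) are the $(m-1)$-cells of the hom-objects. The forgetful functor $U_n:\mathcal V_n\to n\text{-}\mathbf{GSet}$ is $U_0=\mathrm{id}$, and $U_nA$ has objects $A_0$ and homs $U_{n-1}(A(a,a'))$. The $m$-cells of $A\in\mathcal V_n$ are the $m$-cells of $U_nA$. **The monads $Q^{(n)}$.** For a presheaf category $\mathcal V$ and operad $R$ in $\mathcal V$, $\mathbf{fc}_{(\mathcal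 V,R)}$ is the free $(\mathcal V,R)$-category monad on $\mathcal V\text{-}\mathbf{Gph}$: identity on objects, and $$(\mathbf{fc}_{(\mathcal V,R)}A)(a,a')=\coprod_{k\ge0,\ a=a_0,\dots,a_k=a'}R(k)\times A(a_{k-1},a_k)\times\cdots\times A(a_0,a_1).$$ A functor or monad $F$ on $\mathcal V$ induces $F_*$ on $\mathcal V\text{-}\mathbf{Gph}$, the identity on objects and $F$ on hom-objects. Set $Q^{(0)}=\mathrm{id}$ on $\mathbf{Set}$ and, for $n>0$, with $\mathcal V=(n-1)\text{-}\mathbf{GSet}$ and $R(k)=U_{n-1}(P_{n-1}(k))$, $Q^{(n)}=\mathbf{fc}_{(\mathcal V,R)}\circ (Q^{(n-1)})_*$ (a monad via a canonical distributive law; its algebras are $\mathcal V_n$). Taking all $P_i$ to be the terminal operad gives the free strict $n$-category monad $T^{(n)}$, and the maps $P_i\to1$ induce inductively a cartesian natural transformation $Q^{(n)}\Rightarrow T^{(n)}$; "lying over" refers to the component $Q^{(n)}1\to T^{(n)}1$. **Trees.** The $m$-cells of $T^{(n)}1$ are the $m$-stage (planar, possibly degenerate) trees: there is one $0$-stage tree, a single node; an $m$-stage tree is a finite, possibly empty, sequence $(\alpha_1,\dots,\alpha_k)$ of $(m-1)$-stage trees joined by a new base node, of arity $k$ and height $0$, with a node of height $b-1$ in $\alpha_i$ having height $b$ in the new tree. Nodes at the top height $m$ carry no label (labels are for nodes at heights $0\le b<m$). The source and target in $T^{(n)}1$ of an $m$-stage tree are both the $(m-1)$-stage tree obtained by forgetting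 the top level, i.e. the nodes at height $m$; the "top level of labels" is the labels of the nodes at height $m-1$. *)

theory Defs
  imports "HOL-Library.FuncSet"
begin

section \<open>Universe, categories and morphisms\<close>

text \<open>All cells of all categories live in one type, closed under finite tuples, so that
  finite products and coproducts of objects exist inside it.\<close>

datatype 'e elt = Atom 'e | Tup (untup: "'e elt list")

abbreviation coord :: "nat \<Rightarrow> 'e elt \<Rightarrow> 'e elt" where
  "coord i u \<equiv> untup u ! i"

text \<open>Raw data for the objects and morphisms of all the categories \<open>V\<^sub>n\<close> at once: an object of
  \<open>V\<^sub>0\<close> is a set, an object of \<open>V\<^sub>n\<^sub>+\<^sub>1\<close> is a set of objects with homs in \<open>V\<^sub>n\<close> and, for every
  nonempty list \<open>[a\<^sub>0, \<dots>, a\<^sub>k]\<close> of objects, a composition morphism \<open>\<gamma>\<close> of \<open>V\<^sub>n\<close>.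
  Morphisms are total functions, and two morphisms with domain \<open>A\<close> are identified if they
  agree on \<open>A\<close> (\<open>agree\<close> below).\<close>

datatype 'e mor =
    MSet (mob: "'e elt \<Rightarrow> 'e elt")
  | MGph (mob: "'e elt \<Rightarrow> 'e elt") (mhom: "'e elt \<Rightarrow> 'e elt \<Rightarrow> 'e mor")

datatype 'e cat =
    is_CSet: CSet (obs: "'e elt set")
  | is_CCat: CCat (obs: "'e elt set") (hom: "'e elt \<Rightarrow> 'e elt \<Rightarrow> 'e cat")
         (gam: "'e elt list \<Rightarrow> 'e mor")

primrec mid :: "nat \<Rightarrow> 'e mor" where
  "mid 0 = MSet (\<lambda>x. x)"
| "mid (Suc n) = MGph (\<lambda>x. x) (\<lambda>_ _. mid n)"

primrec mcomp :: "nat \<Rightarrow> 'e mor \<Rightarrow> 'e mor \<Rightarrow> 'e mor" where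
  "mcomp 0 G F = MSet (\<lambda>x. mob G (mob F x))"
| "mcomp (Suc n) G F = MGph (\<lambda>x. mob G (mob F x))
     (\<lambda>x y. mcomp n (mhom G (mob F x) (mob F y)) (mhom F x y))"

text \<open>Product projections (the index of the factor starts at 0) and the morphism into a product
  with given components.\<close>

primrec proj :: "nat \<Rightarrow> nat \<Rightarrow> 'e mor" where
  "proj 0 i = MSet (coord i)"
| "proj (Suc n) i = MGph (coord i) (\<lambda>_ _. proj n i)"

primrec pair :: "nat \<Rightarrow> 'e mor list \<Rightarrow> 'e mor" where
  "pair 0 Fs = MSet (\<lambda>x. Tup (map (\<lambda>F. mob F x) Fs))"
| "pair (Suc n) Fs = MGph (\<lambda>x. Tup (map (\<lambda>F. mob F x) Fs))
     (\<lambda>x y. pair n (map (\<lambda>F. mhom F x y) Fs))"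

primrec agree :: "nat \<Rightarrow> 'e cat \<Rightarrow> 'e mor \<Rightarrow> 'e mor \<Rightarrow> bool" where
  "agree 0 A F G \<longleftrightarrow> (\<forall>x\<in>obs A. mob F x = mob G x)"
| "agree (Suc n) A F G \<longleftrightarrow> (\<forall>x\<in>obs A. mob F x = mob G x) \<and>
     (\<forall>x\<in>obs A. \<forall>y\<in>obs A. agree n (hom A x y) (mhom F x y) (mhom G x y))"

text \<open>The product of a list of objects of \<open>V\<^sub>n\<close>. Composition in a product is computed
  componentwise: its \<open>i\<close>-th component is \<open>\<gamma>\<close> of the \<open>i\<close>-th factor after the morphism
  \<open>1 \<times> \<pi>\<^sub>i \<times> \<dots> \<times> \<pi>\<^sub>i\<close>.\<close>

primrec cprod :: "nat \<Rightarrow> 'e cat list \<Rightarrow> 'e cat" where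
  "cprod 0 As = CSet (Tup ` listset (map obs As))"
| "cprod (Suc n) As = CCat (Tup ` listset (map obs As))
     (\<lambda>x y. cprod n (map (\<lambda>i. hom (As ! i) (coord i x) (coord i y)) [0..<length As]))
     (\<lambda>as. pair n (map (\<lambda>i. mcomp n (gam (As ! i) (map (coord i) as))
        (pair n (proj n 0 # map (\<lambda>j. mcomp n (proj n i) (proj n j)) [1..<length as])))
        [0..<length As]))"

text \<open>\<open>h \<times> F \<times> \<dots> \<times> F\<close>, from \<open>X \<times> A(a\<^sub>k\<^sub>-\<^sub>1, a\<^sub>k) \<times> \<dots> \<times> A(a\<^sub>0, a\<^sub>1)\<close>
  to \<open>Y \<times> B(Fa\<^sub>k\<^sub>-\<^sub>1, Fa\<^sub>k) \<times> \<dots> \<times> B(Fa\<^sub>0, Fa\<^sub>1)\<close>, where \<open>as = [a\<^sub>0, \<dots>, a\<^sub>k]\<close>.\<close>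

definition string_map :: "nat \<Rightarrow> 'e mor \<Rightarrow> 'e mor \<Rightarrow> 'e elt list \<Rightarrow> 'e mor" where
  "string_map n h F as = (let k = length as - 1 in
     pair n (mcomp n h (proj n 0) #
       map (\<lambda>i. mcomp n (mhom F (as ! (k - i)) (as ! Suc (k - i))) (proj n i)) [1..<Suc k]))"


section \<open>Operads and the categories \<open>V\<^sub>n\<close>\<close>

text \<open>\<open>opcomp p [k\<^sub>1, \<dots>, k\<^sub>m]\<close> is the composition
  \<open>P(m) \<times> P(k\<^sub>1) \<times> \<dots> \<times> P(k\<^sub>m) \<rightarrow> P(k\<^sub>1 + \<dots> + k\<^sub>m)\<close>.\<close>

record 'e operad =
  ar :: "nat \<Rightarrow> 'e cat"
  opunit :: "'e mor"
  opcomp :: "nat list \<Rightarrow> 'e mor"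

definition offset :: "nat list \<Rightarrow> nat \<Rightarrow> nat" where
  "offset ks i = sum_list (take i ks)"

definition string_homs :: "'e cat \<Rightarrow> 'e elt list \<Rightarrow> 'e cat list" where
  "string_homs A as = map (\<lambda>j. hom A (as ! j) (as ! Suc j)) (rev [0..<length as - 1])"

definition gam_dom :: "nat \<Rightarrow> 'e operad \<Rightarrow> 'e cat \<Rightarrow> 'e elt list \<Rightarrow> 'e cat" where
  "gam_dom n p A as = cprod n (ar p (length as - 1) # string_homs A as)"

text \<open>\<open>is_mor P n A B F\<close>: \<open>F\<close> is a morphism from \<open>A\<close> to \<open>B\<close> in \<open>V\<^sub>n\<close>.\<close>

primrec is_mor :: "(nat \<Rightarrow> 'e operad) \<Rightarrow> nat \<Rightarrow> 'e cat \<Rightarrow> 'e cat \<Rightarrow> 'e mor \<Rightarrow> bool" where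
  "is_mor P 0 A B F \<longleftrightarrow> mob F ` obs A \<subseteq> obs B"
| "is_mor P (Suc n) A B F \<longleftrightarrow>
     mob F ` obs A \<subseteq> obs B \<and>
     (\<forall>a\<in>obs A. \<forall>a'\<in>obs A.
        is_mor P n (hom A a a') (hom B (mob F a) (mob F a')) (mhom F a a')) \<and>
     (\<forall>as. as \<noteq> [] \<and> set as \<subseteq> obs A \<longrightarrow>
        agree n (gam_dom n (P n) A as)
          (mcomp n (mhom F (hd as) (last as)) (gam A as))
          (mcomp n (gam B (map (mob F) as)) (string_map n (mid n) F as)))"

text \<open>Compatibility of the composition of \<open>A\<close> with the composition of the operad \<open>p\<close>, as an
  equation between two morphisms with domain
  \<open>P(m) \<times> P(k\<^sub>1) \<times> \<dots> \<times> P(k\<^sub>m) \<times> A(a\<^sub>K\<^sub>-\<^sub>1, a\<^sub>K) \<times> \<dots> \<times> A(a\<^sub>0, a\<^sub>1)\<close> for \<open>K = k\<^sub>1 + \<dots> + k\<^sub>m\<close>.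
  The \<open>i\<close>-th block (from 0) of \<open>as\<close> runs from index \<open>offset ks i\<close> to \<open>offset ks (Suc i)\<close>;
  the factor \<open>A(a\<^sub>j, a\<^sub>j\<^sub>+\<^sub>1)\<close> is at position \<open>m + K - j\<close>.\<close>

definition gam_assoc :: "nat \<Rightarrow> 'e operad \<Rightarrow> 'e cat \<Rightarrow> nat list \<Rightarrow> 'e elt list \<Rightarrow> bool" where
  "gam_assoc n p A ks as = (let m = length ks; K = sum_list ks in
     agree n (cprod n (ar p m # map (ar p) ks @ string_homs A as))
       (mcomp n (gam A as)
          (pair n (mcomp n (opcomp p ks) (pair n (map (proj n) [0..<Suc m])) #
             map (proj n) [Suc m..<Suc m + K])))
       (mcomp n (gam A (map (\<lambda>i. as ! offset ks i) [0..<Suc m]))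
          (pair n (proj n 0 #
             map (\<lambda>i. mcomp n
                 (gam A (map (\<lambda>j. as ! j) [offset ks i..<Suc (offset ks (Suc i))]))
                 (pair n (proj n (Suc i) #
                    map (\<lambda>j. proj n (m + K - j)) (rev [offset ks i..<offset ks (Suc i)]))))
               (rev [0..<m])))))"

text \<open>\<open>is_obj P n A\<close>: \<open>A\<close> is an object of \<open>V\<^sub>n\<close>, that is, a set for \<open>n = 0\<close> and a
  \<open>(V\<^sub>n\<^sub>-\<^sub>1, P\<^sub>n\<^sub>-\<^sub>1)\<close>-category for \<open>n > 0\<close>. The term \<open>pair n []\<close> is the unique morphism into
  the terminal object \<open>cprod n []\<close>.\<close>

primrec is_obj :: "(nat \<Rightarrow> 'e operad) \<Rightarrow> nat \<Rightarrow> 'e cat \<Rightarrow> bool" where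
  "is_obj P 0 A \<longleftrightarrow> is_CSet A"
| "is_obj P (Suc n) A \<longleftrightarrow>
     is_CCat A \<and>
     (\<forall>a\<in>obs A. \<forall>a'\<in>obs A. is_obj P n (hom A a a')) \<and>
     (\<forall>as. as \<noteq> [] \<and> set as \<subseteq> obs A \<longrightarrow>
        is_mor P n (gam_dom n (P n) A as) (hom A (hd as) (last as)) (gam A as)) \<and>
     (\<forall>a\<in>obs A. \<forall>a'\<in>obs A.
        agree n (hom A a a')
          (mcomp n (gam A [a, a'])
             (pair n [mcomp n (opunit (P n)) (pair n []), mid n]))
          (mid n)) \<and>
     (\<forall>ks as. set as \<subseteq> obs A \<and> length as = Suc (sum_list ks) \<longrightarrow> gam_assoc n (P n) A ks as)"

definition is_operad :: "(nat \<Rightarrow> 'e operad) \<Rightarrow> nat \<Rightarrow> 'e operad \<Rightarrow> bool" where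
  "is_operad P n p \<longleftrightarrow>
     (\<forall>k. is_obj P n (ar p k)) \<and>
     is_mor P n (cprod n []) (ar p 1) (opunit p) \<and>
     (\<forall>ks. is_mor P n (cprod n (ar p (length ks) # map (ar p) ks)) (ar p (sum_list ks))
        (opcomp p ks)) \<and>
     (\<forall>k. agree n (ar p k)
        (mcomp n (opcomp p [k]) (pair n [mcomp n (opunit p) (pair n []), mid n])) (mid n)) \<and>
     (\<forall>k. agree n (ar p k)
        (mcomp n (opcomp p (replicate k 1))
           (pair n (mid n # replicate k (mcomp n (opunit p) (pair n []))))) (mid n)) \<and>
     (\<forall>ls. let m = length ls; ks = map length ls in
        agree n (cprod n (ar p m # map (ar p) ks @ map (ar p) (concat ls)))
          (mcomp n (opcomp p (concat ls))
             (pair n (mcomp n (opcomp p ks) (pair n (map (proj n) [0..<Suc m])) #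
                map (proj n) [Suc m..<Suc m + sum_list ks])))
          (mcomp n (opcomp p (map sum_list ls))
             (pair n (proj n 0 #
                map (\<lambda>i. mcomp n (opcomp p (ls ! i))
                    (pair n (proj n (Suc i) #
                       map (proj n) [Suc m + offset ks i..<Suc m + offset ks (Suc i)])))
                  [0..<m]))))"

primrec contractible :: "'e cat \<Rightarrow> bool" where
  "contractible (CSet X) \<longleftrightarrow> (\<exists>!x. x \<in> X)"
| "contractible (CCat X H g) \<longleftrightarrow> X \<noteq> {} \<and> (\<forall>a\<in>X. \<forall>a'\<in>X. contractible (H a a'))"

text \<open>The category \<open>V\<^sub>n\<close>, given by \<open>is_obj P n\<close> and \<open>is_mor P n\<close>, depends only on
  \<open>P\<^sub>0, \<dots>, P\<^sub>n\<^sub>-\<^sub>1\<close>.\<close>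

definition iterative_theory :: "(nat \<Rightarrow> 'e operad) \<Rightarrow> bool" where
  "iterative_theory P \<longleftrightarrow> (\<forall>n. is_operad P n (P n) \<and> (\<forall>k. contractible (ar (P n) k)))"

definition terminal_operad :: "nat \<Rightarrow> 'e operad" where
  "terminal_operad n =
     \<lparr>ar = \<lambda>_. cprod n [], opunit = pair n [], opcomp = \<lambda>_. pair n []\<rparr>"


section \<open>Globular sets, as iterated graphs\<close>

datatype 'e gph =
    GSet (gobs: "'e elt set")
  | GGph (gobs: "'e elt set") (ghom: "'e elt \<Rightarrow> 'e elt \<Rightarrow> 'e gph")

primrec forget :: "'e cat \<Rightarrow> 'e gph" where
  "forget (CSet X) = GSet X"
| "forget (CCat X H g) = GGph X (\<lambda>a a'. forget (H a a'))"

text \<open>\<open>Step a a' y\<close> is the cell \<open>y\<close> of the hom-object from \<open>a\<close> to \<open>a'\<close>, regarded as a cell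
  one dimension higher.\<close>

datatype 'u cell = Pt 'u | Step 'u 'u "'u cell"

primrec cells :: "nat \<Rightarrow> 'e gph \<Rightarrow> 'e elt cell set" where
  "cells 0 G = Pt ` gobs G"
| "cells (Suc m) G = (case G of GSet X \<Rightarrow> {}
     | GGph X H \<Rightarrow> {Step a a' y | a a' y. a \<in> X \<and> a' \<in> X \<and> y \<in> cells m (H a a')})"

text \<open>Only meaningful on cells of dimension at least 1.\<close>

fun src :: "'u cell \<Rightarrow> 'u cell" where
  "src (Step a a' (Pt x)) = Pt a"
| "src (Step a a' (Step b b' y)) = Step a a' (src (Step b b' y))"
| "src (Pt x) = undefined"

fun tgt :: "'u cell \<Rightarrow> 'u cell" where
  "tgt (Step a a' (Pt x)) = Pt a'"
| "tgt (Step a a' (Step b b' y)) = Step a a' (tgt (Step b b' y))"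
| "tgt (Pt x) = undefined"

text \<open>The action on cells of a morphism of iterated graphs (given by the same data as above).\<close>

primrec app :: "'e elt cell \<Rightarrow> 'e mor \<Rightarrow> 'e elt cell" where
  "app (Pt x) = (\<lambda>F. Pt (mob F x))"
| "app (Step a a' y) = (\<lambda>F. Step (mob F a) (mob F a') (app y (mhom F a a')))"

primrec gempty :: "nat \<Rightarrow> 'e gph" where
  "gempty 0 = GSet {}"
| "gempty (Suc n) = GGph {} (\<lambda>_ _. gempty n)"

primrec gprod :: "nat \<Rightarrow> 'e gph list \<Rightarrow> 'e gph" where
  "gprod 0 Gs = GSet (Tup ` listset (map gobs Gs))"
| "gprod (Suc n) Gs = GGph (Tup ` listset (map gobs Gs))
     (\<lambda>x y. gprod n (map (\<lambda>i. ghom (Gs ! i) (coord i x) (coord i y)) [0..<length Gs]))"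

abbreviation gone :: "nat \<Rightarrow> 'e gph" where
  "gone n \<equiv> gprod n []"

text \<open>The objects of a coproduct are pairs of a tag (the index of the summand) and an object of
  that summand; homs between objects with distinct tags are empty, the others are homs of the
  summand itself.\<close>

abbreviation tagged :: "'e elt \<Rightarrow> 'e elt \<Rightarrow> 'e elt" where "tagged i x \<equiv> Tup [i, x]"
abbreviation tag :: "'e elt \<Rightarrow> 'e elt" where "tag \<equiv> coord 0"
abbreviation val :: "'e elt \<Rightarrow> 'e elt" where "val \<equiv> coord 1"

definition gcoprod_obs :: "'e elt set \<Rightarrow> ('e elt \<Rightarrow> 'e gph) \<Rightarrow> 'e elt set" where
  "gcoprod_obs I G = {tagged i x | i x. i \<in> I \<and> x \<in> gobs (G i)}"

primrec gcoprod :: "nat \<Rightarrow> 'e elt set \<Rightarrow> ('e elt \<Rightarrow> 'e gph) \<Rightarrow> 'e gph" where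
  "gcoprod 0 I G = GSet (gcoprod_obs I G)"
| "gcoprod (Suc n) I G = GGph (gcoprod_obs I G)
     (\<lambda>u v. if tag u = tag v then ghom (G (tag u)) (val u) (val v) else gempty n)"

text \<open>The map of coproducts with action \<open>\<phi>\<close> on tags and \<open>h i\<close> on the \<open>i\<close>-th summand.\<close>

primrec gcoprod_map ::
  "nat \<Rightarrow> ('e elt \<Rightarrow> 'e elt) \<Rightarrow> ('e elt \<Rightarrow> 'e mor) \<Rightarrow> 'e mor" where
  "gcoprod_map 0 \<phi> h = MSet (\<lambda>u. tagged (\<phi> (tag u)) (mob (h (tag u)) (val u)))"
| "gcoprod_map (Suc n) \<phi> h = MGph (\<lambda>u. tagged (\<phi> (tag u)) (mob (h (tag u)) (val u)))
     (\<lambda>u v. mhom (h (tag u)) (val u) (val v))"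


section \<open>The monads \<open>Q\<close> and \<open>T\<close>\<close>

text \<open>\<open>fc n R A\<close> is the free category construction on a graph \<open>A\<close> in \<open>n\<close>-globular sets; the
  summands are tagged by the strings \<open>a\<^sub>0, \<dots>, a\<^sub>k\<close>.\<close>

definition strings :: "'e elt set \<Rightarrow> 'e elt \<Rightarrow> 'e elt \<Rightarrow> 'e elt set" where
  "strings X a a' = {Tup as | as. as \<noteq> [] \<and> set as \<subseteq> X \<and> hd as = a \<and> last as = a'}"

definition fc_summand :: "nat \<Rightarrow> (nat \<Rightarrow> 'e gph) \<Rightarrow> 'e gph \<Rightarrow> 'e elt list \<Rightarrow> 'e gph" where
  "fc_summand n R A as = (let k = length as - 1 in
     gprod n (R k # map (\<lambda>j. ghom A (as ! j) (as ! Suc j)) (rev [0..<k])))"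

definition fc :: "nat \<Rightarrow> (nat \<Rightarrow> 'e gph) \<Rightarrow> 'e gph \<Rightarrow> 'e gph" where
  "fc n R A = GGph (gobs A)
     (\<lambda>a a'. gcoprod n (strings (gobs A) a a') (\<lambda>i. fc_summand n R A (untup i)))"

text \<open>The map \<open>fc n R A \<rightarrow> fc n S B\<close> induced by maps \<open>\<rho> k\<close> from \<open>R k\<close> to \<open>S k\<close> and \<open>F\<close> from
  \<open>A\<close> to \<open>B\<close>.\<close>

definition fc_map :: "nat \<Rightarrow> (nat \<Rightarrow> 'e mor) \<Rightarrow> 'e mor \<Rightarrow> 'e mor" where
  "fc_map n \<rho> F = MGph (mob F)
     (\<lambda>a a'. gcoprod_map n (\<lambda>i. Tup (map (mob F) (untup i)))
        (\<lambda>i. string_map n (\<rho> (length (untup i) - 1)) F (untup i)))"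

definition star :: "('e gph \<Rightarrow> 'e gph) \<Rightarrow> 'e gph \<Rightarrow> 'e gph" where
  "star \<Phi> A = GGph (gobs A) (\<lambda>a a'. \<Phi> (ghom A a a'))"

definition star_map :: "('e gph \<Rightarrow> 'e mor) \<Rightarrow> 'e gph \<Rightarrow> 'e mor" where
  "star_map \<theta> A = MGph (\<lambda>a. a) (\<lambda>a a'. \<theta> (ghom A a a'))"

primrec Q :: "(nat \<Rightarrow> 'e operad) \<Rightarrow> nat \<Rightarrow> 'e gph \<Rightarrow> 'e gph" where
  "Q P 0 = (\<lambda>A. A)"
| "Q P (Suc n) = (\<lambda>A. fc n (\<lambda>k. forget (ar (P n) k)) (star (Q P n) A))"

abbreviation T :: "nat \<Rightarrow> 'e gph \<Rightarrow> 'e gph" where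
  "T \<equiv> Q terminal_operad"

text \<open>The component at \<open>A\<close> of the transformation from \<open>Q P n\<close> to \<open>T n\<close>. It does not mention \<open>P\<close>,
  as \<open>pair n []\<close> is the map from every \<open>P\<^sub>n(k)\<close> to the terminal object. A cell \<open>x\<close> of
  \<open>Q P n (gone n)\<close> lies over \<open>over n x\<close>.\<close>

primrec q :: "nat \<Rightarrow> 'e gph \<Rightarrow> 'e mor" where
  "q 0 = (\<lambda>A. mid 0)"
| "q (Suc n) = (\<lambda>A. fc_map n (\<lambda>k. pair n []) (star_map (q n) A))"

definition over :: "nat \<Rightarrow> 'e elt cell \<Rightarrow> 'e elt cell" where
  "over n x = app x (q n (gone n))"


section \<open>Trees\<close>

datatype tree = Node (children: "tree list")

text \<open>The number of stages is not part of a tree: an \<open>m\<close>-stage tree is a tree with no nodes above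
  height \<open>m\<close>, regarded as having \<open>m\<close> stages.\<close>

text \<open>Nodes are addressed by the path from the base node; the height is the length of the path.\<close>

primrec is_node :: "nat list \<Rightarrow> tree \<Rightarrow> bool" where
  "is_node [] t \<longleftrightarrow> True"
| "is_node (i # p) t \<longleftrightarrow> i < length (children t) \<and> is_node p (children t ! i)"

primrec arity :: "nat list \<Rightarrow> tree \<Rightarrow> nat" where
  "arity [] t = length (children t)"
| "arity (i # p) t = arity p (children t ! i)"

definition nodes_below :: "nat \<Rightarrow> tree \<Rightarrow> nat list set" where
  "nodes_below m t = {p. is_node p t \<and> length p < m}"

text \<open>\<open>trunc m t\<close> forgets all nodes above height \<open>m\<close>.\<close>

primrec trunc :: "nat \<Rightarrow> tree \<Rightarrow> tree" where
  "trunc 0 t = Node []"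
| "trunc (Suc m) t = Node (map (trunc m) (children t))"

text \<open>A cell of positive dimension of a free category lies in a summand
  \<open>R(k) \<times> A(a\<^sub>k\<^sub>-\<^sub>1, a\<^sub>k) \<times> \<dots> \<times> A(a\<^sub>0, a\<^sub>1)\<close>; its factors are indexed from 0. Projections out of
  a product act by the same function on elements at every level, hence \<open>map_cell\<close>.\<close>

fun string_length :: "'e elt cell \<Rightarrow> nat" where
  "string_length (Step a a' (Pt u)) = length (untup (tag u)) - 1"
| "string_length (Step a a' (Step u v y)) = length (untup (tag u)) - 1"
| "string_length (Pt x) = 0"

fun untag :: "'e elt cell \<Rightarrow> 'e elt cell" where
  "untag (Pt u) = Pt (val u)"
| "untag (Step u v y) = Step (val u) (val v) y"

fun factor :: "nat \<Rightarrow> 'e elt cell \<Rightarrow> 'e elt cell" where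
  "factor j (Step a a' y) = map_cell (coord j) (untag y)"
| "factor j (Pt x) = undefined"

text \<open>The component of \<open>x\<close> in \<open>A(a\<^sub>i, a\<^sub>i\<^sub>+\<^sub>1)\<close>.\<close>

definition branch :: "nat \<Rightarrow> 'e elt cell \<Rightarrow> 'e elt cell" where
  "branch i x = factor (string_length x - i) x"

text \<open>The \<open>m\<close>-stage tree corresponding to an \<open>m\<close>-cell of \<open>T n (gone n)\<close>. The subtrees are
  ordered along the string: the \<open>i\<close>-th one (from 0) is the component in \<open>A(a\<^sub>i, a\<^sub>i\<^sub>+\<^sub>1)\<close>.\<close>

primrec tree_of :: "nat \<Rightarrow> 'e elt cell \<Rightarrow> tree" where
  "tree_of 0 x = Node []"
| "tree_of (Suc m) x = Node (map (\<lambda>i. tree_of m (branch i x)) [0..<string_length x])"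


section \<open>Labels\<close>

text \<open>A cell of positive dimension of \<open>Q P n (gone n)\<close> is a cell of \<open>P\<^sub>n\<^sub>-\<^sub>1(k)\<close>, which labels the
  base node, together with \<open>k\<close> cells of \<open>Q P (n - 1) (gone (n - 1))\<close>, which give the labels of
  the subtrees.\<close>

primrec node_label :: "nat list \<Rightarrow> 'e elt cell \<Rightarrow> 'e elt cell" where
  "node_label [] x = factor 0 x"
| "node_label (i # p) x = node_label p (branch i x)"

definition labelling :: "nat \<Rightarrow> tree \<Rightarrow> 'e elt cell \<Rightarrow> nat list \<Rightarrow> 'e elt cell" where
  "labelling m t x = restrict (\<lambda>p. node_label p x) (nodes_below m t)"

definition labellings ::
  "(nat \<Rightarrow> 'e operad) \<Rightarrow> nat \<Rightarrow> nat \<Rightarrow> tree \<Rightarrow> (nat list \<Rightarrow> 'e elt cell) set" where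
  "labellings P n m t = (\<Pi>\<^sub>E p\<in>nodes_below m t.
     cells (m - length p - 1) (forget (ar (P (n - length p - 1)) (arity p t))))"

end

theory Submission
  imports Defs
begin

text \<open>A positive-dimensional cell of \<open>Q\<^sup>(\<^sup>n\<^sup>+\<^sup>1\<^sup>)(1)\<close> is a cell of \<open>P\<^sub>n(k)\<close> together with \<open>k\<close> cells of
  \<open>Q\<^sup>(\<^sup>n\<^sup>)(1)\<close>, all one dimension lower, because cells of a product or coproduct of globular
  sets are tuples of cells or cells of a summand. Neither the tree nor its underlying string
  structure involves the \<open>P\<^sub>n(k)\<close>, so a cell and its image in \<open>T\<^sup>(\<^sup>n\<^sup>)(1)\<close> have the same tree, and
  unfolding this decomposition gives the labels. Applied to the terminal operads it also
  shows that a cell of \<open>T\<^sup>(\<^sup>n\<^sup>)(1)\<close> is determined by its tree. The decomposition commutes with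
  source and target in dimension at least 2.\<close>

section \<open>Cells of products and coproducts\<close>

primrec cdim :: "'u cell \<Rightarrow> nat" where
  "cdim (Pt x) = 0"
| "cdim (Step a a' y) = Suc (cdim y)"

lemma cdim_cells: "x \<in> cells m G \<Longrightarrow> cdim x = m"
  by (induction m arbitrary: x G) (auto split: gph.splits)

text \<open>The datatype \<open>gph\<close> allows homs of varying depth. This predicate singles out
  the members of n-Gph, in which \<open>ghom\<close> is meaningful at every level above the bottom
  one.\<close>

primrec is_ngph :: "nat \<Rightarrow> 'e gph \<Rightarrow> bool" where
  "is_ngph 0 G \<longleftrightarrow> (\<exists>X. G = GSet X)"
| "is_ngph (Suc n) G \<longleftrightarrow> (\<exists>X H. G = GGph X H) \<and>
     (\<forall>a\<in>gobs G. \<forall>a'\<in>gobs G. is_ngph n (ghom G a a'))"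

lemma cells_Suc_ngph:
  assumes "is_ngph (Suc n) G"
  shows "cells (Suc m) G = {Step a a' y | a a' y. a \<in> gobs G \<and> a' \<in> gobs G \<and> y \<in> cells m (ghom G a a')}"
  using assms by (cases G) auto

section \<open>Cells of a product as tuples of cells\<close>

lemma listset_iff:
  "xs \<in> listset As \<longleftrightarrow> length xs = length As \<and> (\<forall>i<length As. xs ! i \<in> As ! i)"
proof (induction As arbitrary: xs)
  case (Cons A As)
  then show ?case
    by (cases xs) (auto simp: set_Cons_def nth_Cons split: nat.splits)
qed simp

lemma gobs_gprod: "gobs (gprod n Gs) = Tup ` listset (map gobs Gs)"
  by (cases n) auto

lemma is_ngph_gprod:
  "\<forall>G\<in>set Gs. is_ngph n G \<Longrightarrow> is_ngph n (gprod n Gs)"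
proof (induction n arbitrary: Gs)
  case (Suc n)
  have "is_ngph n (gprod n (map (\<lambda>i. ghom (Gs ! i) (xs ! i) (ys ! i)) [0..<length Gs]))"
    if "xs \<in> listset (map gobs Gs)" "ys \<in> listset (map gobs Gs)" for xs ys
    using that Suc.prems by (intro Suc.IH) (auto simp: listset_iff)
  then show ?case
    by auto
qed simp

text \<open>Induction on the dimension: a hom of a product is the product of the homs between
  corresponding coordinates, so the inner cell falls under the induction hypothesis for that list of
  homs.\<close>

lemma coord_cells_gprod:
  assumes "y \<in> cells m (gprod n Gs)" "j < length Gs" "m \<le> n" "\<forall>G\<in>set Gs. is_ngph n G"
  shows "map_cell (coord j) y \<in> cells m (Gs ! j)"
  using assms
proof (induction m arbitrary: n Gs y)
  case 0
  then show ?case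
    by (auto simp: gobs_gprod listset_iff)
next
  case (Suc m)
  then obtain n' where n: "n = Suc n'"
    by (cases n) auto
  from Suc.prems n obtain xs ys z where y: "y = Step (Tup xs) (Tup ys) z"
    and xs: "xs \<in> listset (map gobs Gs)" and ys: "ys \<in> listset (map gobs Gs)"
    and z: "z \<in> cells m (gprod n' (map (\<lambda>i. ghom (Gs ! i) (xs ! i) (ys ! i)) [0..<length Gs]))"
    by auto
  have "map_cell (coord j) z \<in> cells m (map (\<lambda>i. ghom (Gs ! i) (xs ! i) (ys ! i)) [0..<length Gs] ! j)"
    using Suc.prems n xs ys by (intro Suc.IH[OF z]) (auto simp: listset_iff)
  moreover have ngph: "is_ngph (Suc n') (Gs ! j)"
    using Suc.prems n by auto
  moreover have "xs ! j \<in> gobs (Gs ! j)" "ys ! j \<in> gobs (Gs ! j)"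
    using xs ys Suc.prems(2) by (auto simp: listset_iff)
  ultimately show ?case
    using Suc.prems(2) unfolding cells_Suc_ngph[OF ngph] by (simp add: y)
qed

text \<open>Objects of a product are tuples of a fixed length, so equality of end objects can be
  tested coordinatewise. Once the end objects agree, the inner cells lie in the same product of homs
  and the induction continues.\<close>

lemma cells_gprod_eqI:
  assumes "y \<in> cells m (gprod n Gs)" "z \<in> cells m (gprod n Gs)"
    and "\<And>j. j < length Gs \<Longrightarrow> map_cell (coord j) y = map_cell (coord j) z" and "m \<le> n"
  shows "y = z"
  using assms
proof (induction m arbitrary: n Gs y z)
  case 0
  then show ?case
    by (auto simp: gobs_gprod listset_iff intro: nth_equalityI)
next
  case (Suc m)
  then obtain n' where n: "n = Suc n'"
    by (cases n) auto
  define H where "H xs ys = map (\<lambda>i. ghom (Gs ! i) (xs ! i) (ys ! i)) [0..<length Gs]" for xs ys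
  from Suc.prems(1) n obtain xs ys y' where y: "y = Step (Tup xs) (Tup ys) y'"
    and xy: "xs \<in> listset (map gobs Gs)" "ys \<in> listset (map gobs Gs)"
    and y': "y' \<in> cells m (gprod n' (H xs ys))"
    by (auto simp: H_def)
  from Suc.prems(2) n obtain us vs z' where z: "z = Step (Tup us) (Tup vs) z'"
    and uv: "us \<in> listset (map gobs Gs)" "vs \<in> listset (map gobs Gs)"
    and z': "z' \<in> cells m (gprod n' (H us vs))"
    by (auto simp: H_def)
  have "us = xs" "vs = ys"
    using xy uv Suc.prems(3) by (auto simp: y z listset_iff intro!: nth_equalityI)
  moreover have "y' = z'"
  proof (rule Suc.IH)
    show "y' \<in> cells m (gprod n' (H xs ys))" "z' \<in> cells m (gprod n' (H xs ys))"
      using y' z' \<open>us = xs\<close> \<open>vs = ys\<close> by auto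
    show "map_cell (coord j) y' = map_cell (coord j) z'" if "j < length (H xs ys)" for j
      using Suc.prems(3)[of j] that by (simp add: H_def y z)
    show "m \<le> n'"
      using Suc.prems n by simp
  qed
  ultimately show ?case
    by (simp add: y z)
qed

text \<open>The existence half of the tuple description. The end objects of the given cells are
  collected into two tuples, and the inner cells are tupled by induction.\<close>

lemma cells_gprod_ex:
  assumes "\<And>j. j < length Gs \<Longrightarrow> c j \<in> cells m (Gs ! j)" "m \<le> n" "\<forall>G\<in>set Gs. is_ngph n G"
  shows "\<exists>y\<in>cells m (gprod n Gs). \<forall>j<length Gs. map_cell (coord j) y = c j"
  using assms
proof (induction m arbitrary: n Gs c)
  case 0
  then have "\<forall>j<length Gs. \<exists>x\<in>gobs (Gs ! j). c j = Pt x"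
    by auto
  then obtain x where x: "\<And>j. j < length Gs \<Longrightarrow> x j \<in> gobs (Gs ! j) \<and> c j = Pt (x j)"
    by metis
  then show ?case
    by (intro bexI[of _ "Pt (Tup (map x [0..<length Gs]))"]) (auto simp: gobs_gprod listset_iff)
next
  case (Suc m)
  then obtain n' where n: "n = Suc n'"
    by (cases n) auto
  have "\<exists>a b y. c j = Step a b y \<and> a \<in> gobs (Gs ! j) \<and> b \<in> gobs (Gs ! j) \<and> y \<in> cells m (ghom (Gs ! j) a b)"
    if "j < length Gs" for j
  proof -
    have "is_ngph (Suc n') (Gs ! j)"
      using that Suc.prems n by auto
    then show ?thesis
      using Suc.prems(1)[OF that] unfolding cells_Suc_ngph[OF \<open>is_ngph (Suc n') (Gs ! j)\<close>] by blast
  qed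
  then obtain a b y where c: "\<And>j. j < length Gs \<Longrightarrow>
      c j = Step (a j) (b j) (y j) \<and> a j \<in> gobs (Gs ! j) \<and> b j \<in> gobs (Gs ! j) \<and>
      y j \<in> cells m (ghom (Gs ! j) (a j) (b j))"
    by metis
  define as bs where "as = map a [0..<length Gs]" and "bs = map b [0..<length Gs]"
  define H where "H = map (\<lambda>i. ghom (Gs ! i) (as ! i) (bs ! i)) [0..<length Gs]"
  have "\<exists>z\<in>cells m (gprod n' H). \<forall>j<length H. map_cell (coord j) z = y j"
    using Suc.prems n c by (intro Suc.IH) (auto simp: H_def as_def bs_def)
  then obtain z where z: "z \<in> cells m (gprod n' H)"
    "\<And>j. j < length Gs \<Longrightarrow> map_cell (coord j) z = y j"
    by (auto simp: H_def)
  have "Step (Tup as) (Tup bs) z \<in> cells (Suc m) (gprod n Gs)"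
    using z c by (auto simp: n as_def bs_def listset_iff H_def)
  moreover have "\<forall>j<length Gs. map_cell (coord j) (Step (Tup as) (Tup bs) z) = c j"
    using z c by (simp add: as_def bs_def)
  ultimately show ?case
    by blast
qed

section \<open>Cells of a coproduct as cells of a summand\<close>

text \<open>The coproduct inclusion on cells. Only the two outermost objects receive the tag,
  because the homs of a coproduct between objects with equal tags are the homs of the summand
  itself.\<close>

fun tagcell :: "'e elt \<Rightarrow> 'e elt cell \<Rightarrow> 'e elt cell" where
  "tagcell i (Pt x) = Pt (tagged i x)"
| "tagcell i (Step a a' y) = Step (tagged i a) (tagged i a') y"

lemma untag_tagcell [simp]: "untag (tagcell i y) = y"
  by (cases y) auto

lemma string_length_tagcell [simp]:
  "string_length (Step a a' (tagcell i y)) = length (untup i) - 1"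
  by (cases y) auto

lemma cells_gempty [simp]: "cells m (gempty n) = {}"
  by (cases m; cases n) auto

lemma is_ngph_gempty: "is_ngph n (gempty n)"
  by (induction n) auto

lemma gobs_gcoprod: "gobs (gcoprod n I G) = gcoprod_obs I G"
  by (cases n) auto

lemma is_ngph_gcoprod:
  "\<forall>i\<in>I. is_ngph n (G i) \<Longrightarrow> is_ngph n (gcoprod n I G)"
  by (cases n) (auto simp: gcoprod_obs_def is_ngph_gempty)

text \<open>Homs between objects with distinct tags are empty, so no cell of positive dimension runs
  between two summands.\<close>

lemma cells_gcoprod:
  assumes "\<forall>i\<in>I. is_ngph n (G i)" "m \<le> n"
  shows "cells m (gcoprod n I G) = (\<Union>i\<in>I. tagcell i ` cells m (G i))"
proof (cases m)
  case 0
  then show ?thesis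
    by (auto simp: gobs_gcoprod gcoprod_obs_def image_iff)
next
  case (Suc m')
  with assms obtain n' where n: "n = Suc n'"
    by (cases n) auto
  have *: "cells m (G i) =
      {Step a a' y | a a' y. a \<in> gobs (G i) \<and> a' \<in> gobs (G i) \<and> y \<in> cells m' (ghom (G i) a a')}"
    if "i \<in> I" for i
    unfolding Suc using assms(1) that n by (intro cells_Suc_ngph) auto
  have "cells m (gcoprod n I G) = {Step (tagged i a) (tagged i a') y | i a a' y. i \<in> I \<and>
      a \<in> gobs (G i) \<and> a' \<in> gobs (G i) \<and> y \<in> cells m' (ghom (G i) a a')}"
    unfolding Suc n by (fastforce simp: gcoprod_obs_def split: if_splits)
  also have "\<dots> = (\<Union>i\<in>I. tagcell i ` cells m (G i))"
    by (force simp: * image_iff)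
  finally show ?thesis .
qed


section \<open>Cells of the free categories on the terminal graph\<close>

lemma is_ngph_gone: "is_ngph n (gone n)"
  by (rule is_ngph_gprod) simp

lemma gobs_Q: "gobs (Q P n A) = gobs A"
  by (cases n) (auto simp: fc_def star_def)

lemma cells_0_Q: "cells 0 (Q P n (gone n)) = {Pt (Tup [])}"
  by (simp add: gobs_Q gobs_gprod)

text \<open>The terminal graph has the single object \<open>Tup []\<close>, so a string is
  determined by its number \<open>k\<close> of edges; it consists of \<open>k + 1\<close> copies of
  that object.\<close>

abbreviation const_string :: "nat \<Rightarrow> 'e elt" where
  "const_string k \<equiv> Tup (replicate (Suc k) (Tup []))"

lemma strings_singleton:
  "strings {Tup []} (Tup []) (Tup []) = range const_string"
proof -
  have "as = replicate (Suc (length as - 1)) (Tup [])" if "as \<noteq> []" "set as \<subseteq> {Tup []}" for as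
    using that by (auto intro: replicate_eqI simp del: replicate_Suc)
  then show ?thesis
    by (fastforce simp: strings_def simp del: replicate_Suc)
qed

text \<open>The factors of the summand for strings with \<open>k\<close> edges in the only hom of
  \<open>Q P (Suc n) (gone (Suc n))\<close>. All edges contribute the same factor, since the only
  hom of \<open>gone (Suc n)\<close> is \<open>gone n\<close>.\<close>

definition Q_summand :: "(nat \<Rightarrow> 'e operad) \<Rightarrow> nat \<Rightarrow> nat \<Rightarrow> 'e gph list" where
  "Q_summand P n k = forget (ar (P n) k) # replicate k (Q P n (gone n))"

lemma ghom_Q_Suc:
  "ghom (Q P (Suc n) (gone (Suc n))) (Tup []) (Tup []) =
     gcoprod n (range const_string) (\<lambda>i. gprod n (Q_summand P n (length (untup i) - 1)))"
  by (simp add: fc_def star_def strings_singleton fc_summand_def Q_summand_def Let_def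
        map_replicate_const)

text \<open>The consequence of \<open>iterative_theory\<close> from which the argument proceeds. It
  can be checked directly for \<open>terminal_operad\<close>, so that every result about
  \<open>Q\<close> can also be applied to \<open>T\<close>.\<close>

definition operads_in_gph :: "(nat \<Rightarrow> 'e operad) \<Rightarrow> bool" where
  "operads_in_gph P \<longleftrightarrow> (\<forall>n k. is_ngph n (forget (ar (P n) k)))"

lemma is_obj_imp_is_ngph: "is_obj P n A \<Longrightarrow> is_ngph n (forget A)"
  by (induction n arbitrary: A) (auto simp: is_CSet_def is_CCat_def)

lemma iterative_theory_operads_in_gph: "iterative_theory P \<Longrightarrow> operads_in_gph P"
  unfolding iterative_theory_def is_operad_def operads_in_gph_def
  using is_obj_imp_is_ngph by blast

lemma forget_cprod_Nil: "forget (cprod n []) = gone n"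
  by (induction n) auto

lemma terminal_operads_in_gph: "operads_in_gph terminal_operad"
  by (simp add: operads_in_gph_def terminal_operad_def forget_cprod_Nil is_ngph_gone)

lemma is_ngph_Q: "operads_in_gph P \<Longrightarrow> is_ngph n (Q P n (gone n))"
proof (induction n)
  case (Suc n)
  then have "is_ngph n (gprod n (Q_summand P n k))" for k
    by (intro is_ngph_gprod) (auto simp: Q_summand_def operads_in_gph_def)
  then have "is_ngph n (ghom (Q P (Suc n) (gone (Suc n))) (Tup []) (Tup []))"
    unfolding ghom_Q_Suc by (intro is_ngph_gcoprod) auto
  moreover have "gobs (Q P (Suc n) (gone (Suc n))) = {Tup []}"
    unfolding gobs_Q gobs_gprod by simp
  moreover have "\<exists>X H. Q P (Suc n) (gone (Suc n)) = GGph X H"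
    by (simp add: fc_def)
  ultimately show ?case
    unfolding is_ngph.simps by simp
qed auto

lemma is_ngph_Q_summand: "operads_in_gph P \<Longrightarrow> \<forall>G\<in>set (Q_summand P n k). is_ngph n G"
  by (auto simp: Q_summand_def is_ngph_Q operads_in_gph_def)

text \<open>With a single object, the coproduct over strings becomes a choice of \<open>k\<close>,
  and the outermost \<open>Step\<close> carries no information.\<close>

lemma cells_Q_Suc:
  assumes "operads_in_gph P" "m \<le> n"
  shows "cells (Suc m) (Q P (Suc n) (gone (Suc n))) =
    {Step (Tup []) (Tup []) (tagcell (const_string k) y) | k y. y \<in> cells m (gprod n (Q_summand P n k))}"
proof -
  have "cells (Suc m) (Q P (Suc n) (gone (Suc n))) =
      Step (Tup []) (Tup []) ` cells m (ghom (Q P (Suc n) (gone (Suc n))) (Tup []) (Tup []))"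
    unfolding cells_Suc_ngph[OF is_ngph_Q[OF assms(1)]] gobs_Q gobs_gprod by auto
  also have "cells m (ghom (Q P (Suc n) (gone (Suc n))) (Tup []) (Tup [])) =
      (\<Union>k. tagcell (const_string k) ` cells m (gprod n (Q_summand P n k)))"
    unfolding ghom_Q_Suc using assms
    by (subst cells_gcoprod) (auto intro!: is_ngph_gprod is_ngph_Q_summand)
  finally show ?thesis
    by auto
qed

section \<open>The base label and the branches of a cell\<close>

lemma factor_tagcell [simp]:
  "factor j (Step a a' (tagcell i y)) = map_cell (coord j) y"
  by simp

lemma factor_0_cells_Q:
  assumes "operads_in_gph P" "m \<le> n" "x \<in> cells (Suc m) (Q P (Suc n) (gone (Suc n)))"
  shows "factor 0 x \<in> cells m (forget (ar (P n) (string_length x)))"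
proof -
  obtain k y where x: "x = Step (Tup []) (Tup []) (tagcell (const_string k) y)"
    and y: "y \<in> cells m (gprod n (Q_summand P n k))"
    using assms(3) unfolding cells_Q_Suc[OF assms(1,2)] by auto
  have "map_cell (coord 0) y \<in> cells m (Q_summand P n k ! 0)"
    by (rule coord_cells_gprod[OF y _ assms(2) is_ngph_Q_summand[OF assms(1)]])
      (simp add: Q_summand_def)
  then show ?thesis
    by (simp add: x Q_summand_def)
qed

lemma branch_cells_Q:
  assumes "operads_in_gph P" "m \<le> n" "x \<in> cells (Suc m) (Q P (Suc n) (gone (Suc n)))"
    and "i < string_length x"
  shows "branch i x \<in> cells m (Q P n (gone n))"
proof -
  obtain k y where x: "x = Step (Tup []) (Tup []) (tagcell (const_string k) y)"
    and y: "y \<in> cells m (gprod n (Q_summand P n k))"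
    using assms(3) unfolding cells_Q_Suc[OF assms(1,2)] by auto
  \<comment> \<open>The edge factors run against the direction of the string and come after the
    factor with index 0, which is the label; hence branch \<open>i\<close> is the factor with index
    \<open>k - i\<close>, which is nonzero as \<open>i < k\<close>.\<close>
  have "map_cell (coord (k - i)) y \<in> cells m (Q_summand P n k ! (k - i))"
    by (rule coord_cells_gprod[OF y _ assms(2) is_ngph_Q_summand[OF assms(1)]])
      (simp add: Q_summand_def)
  then show ?thesis
    using assms(4) by (simp add: x branch_def Q_summand_def nth_Cons')
qed

text \<open>Injectivity of the decomposition: the base label and the branches together exhaust the
  factors of the product.\<close>

lemma cells_Q_Suc_eqI:
  assumes "operads_in_gph P" "m \<le> n"
    and "x \<in> cells (Suc m) (Q P (Suc n) (gone (Suc n)))"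
    and "x' \<in> cells (Suc m) (Q P (Suc n) (gone (Suc n)))"
    and "string_length x = string_length x'" "factor 0 x = factor 0 x'"
    and br: "\<And>i. i < string_length x \<Longrightarrow> branch i x = branch i x'"
  shows "x = x'"
proof -
  obtain k y where x: "x = Step (Tup []) (Tup []) (tagcell (const_string k) y)"
    and y: "y \<in> cells m (gprod n (Q_summand P n k))"
    using assms(3) unfolding cells_Q_Suc[OF assms(1,2)] by auto
  obtain k' y' where x': "x' = Step (Tup []) (Tup []) (tagcell (const_string k') y')"
    and y': "y' \<in> cells m (gprod n (Q_summand P n k'))"
    using assms(4) unfolding cells_Q_Suc[OF assms(1,2)] by auto
  have k: "k' = k"
    using assms(5) by (simp add: x x')
  have "y = y'"
  proof (rule cells_gprod_eqI[OF y y'[unfolded k] _ assms(2)])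
    fix j assume j: "j < length (Q_summand P n k)"
    show "map_cell (coord j) y = map_cell (coord j) y'"
    proof (cases j)
      case 0
      then show ?thesis
        using assms(6) by (simp add: x x')
    next
      case (Suc j')
      then show ?thesis
        \<comment> \<open>The reversal sending \<open>i\<close> to \<open>k - i\<close> is its own
          inverse, so the factor with index \<open>j > 0\<close> is branch
          \<open>k - j\<close>.\<close>
        using br[of "k - j"] j by (simp add: x x' k branch_def Q_summand_def)
    qed
  qed
  then show ?thesis
    by (simp add: x x' k)
qed

text \<open>Surjectivity of the decomposition: the base label and the branches can be prescribed
  independently, subject only to their number matching the arity.\<close>

lemma cells_Q_Suc_ex:
  assumes "operads_in_gph P" "m \<le> n" "r \<in> cells m (forget (ar (P n) k))"
    and "\<And>i. i < k \<Longrightarrow> b i \<in> cells m (Q P n (gone n))"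
  shows "\<exists>x\<in>cells (Suc m) (Q P (Suc n) (gone (Suc n))).
    string_length x = k \<and> factor 0 x = r \<and> (\<forall>i<k. branch i x = b i)"
proof -
  define c where "c j = (if j = 0 then r else b (k - j))" for j
  have "\<exists>y\<in>cells m (gprod n (Q_summand P n k)). \<forall>j<length (Q_summand P n k). map_cell (coord j) y = c j"
    using assms by (intro cells_gprod_ex is_ngph_Q_summand)
      (auto simp: c_def Q_summand_def nth_Cons')
  then obtain y where y: "y \<in> cells m (gprod n (Q_summand P n k))"
    and yc: "\<And>j. j \<le> k \<Longrightarrow> map_cell (coord j) y = c j"
    by (auto simp: Q_summand_def)
  have "Step (Tup []) (Tup []) (tagcell (const_string k) y) \<in> cells (Suc m) (Q P (Suc n) (gone (Suc n)))"
    unfolding cells_Q_Suc[OF assms(1,2)] using y by blast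
  then show ?thesis
    by (rule bexI[rotated]) (simp add: branch_def yc c_def)
qed


section \<open>The projection to trees\<close>

lemma app_mcomp: "cdim y \<le> n \<Longrightarrow> app y (mcomp n G F) = app (app y F) G"
proof (induction y arbitrary: n G F)
  case (Pt x)
  then show ?case by (cases n) auto
next
  case (Step a a' y)
  then show ?case by (cases n) auto
qed

text \<open>The raw morphisms \<open>proj n\<close>, \<open>mcomp n\<close> and
  \<open>pair n\<close> carry data only down to level \<open>n\<close>, whence the bound on the
  dimension of the cell.\<close>

lemma app_proj: "cdim y \<le> n \<Longrightarrow> app y (proj n j) = map_cell (coord j) y"
proof (induction y arbitrary: n)
  case (Pt x)
  then show ?case by (cases n) auto
next
  case (Step a a' y)
  then show ?case by (cases n) auto
qed

lemma mob_pair [simp]: "mob (pair n Fs) x = Tup (map (\<lambda>F. mob F x) Fs)"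
  by (cases n) auto

lemma coord_app_pair:
  "cdim y \<le> n \<Longrightarrow> j < length Fs \<Longrightarrow> map_cell (coord j) (app y (pair n Fs)) = app y (Fs ! j)"
proof (induction y arbitrary: n Fs)
  case (Step a a' y)
  then show ?case by (cases n) auto
qed simp

text \<open>The universal property of the product on a single cell. No domain graph is fixed: all
  conditions concern the images of \<open>y\<close>, so the induction passes freely to the hom
  components of the morphisms.\<close>

lemma app_pair_cells_gprod:
  assumes "cdim y = m" "m \<le> n" "length Fs = length Gs" "\<forall>G\<in>set Gs. is_ngph n G"
    and "\<And>j. j < length Gs \<Longrightarrow> app y (Fs ! j) \<in> cells m (Gs ! j)"
  shows "app y (pair n Fs) \<in> cells m (gprod n Gs)"
  using assms
proof (induction m arbitrary: n y Fs Gs)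
  case 0
  then obtain x where "y = Pt x"
    by (cases y) auto
  moreover from this have "mob (Fs ! j) x \<in> gobs (Gs ! j)" if "j < length Gs" for j
    using 0(5)[OF that] by auto
  ultimately show ?case
    using 0(3) by (simp add: gobs_gprod listset_iff)
next
  case (Suc m)
  then obtain n' where n: "n = Suc n'"
    by (cases n) auto
  from Suc.prems obtain a a' z where y: "y = Step a a' z"
    by (cases y) auto
  have step: "mob (Fs ! j) a \<in> gobs (Gs ! j) \<and> mob (Fs ! j) a' \<in> gobs (Gs ! j) \<and>
      app z (mhom (Fs ! j) a a') \<in> cells m (ghom (Gs ! j) (mob (Fs ! j) a) (mob (Fs ! j) a')) \<and>
      is_ngph n' (ghom (Gs ! j) (mob (Fs ! j) a) (mob (Fs ! j) a'))"
    if "j < length Gs" for j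
  proof -
    have *: "is_ngph (Suc n') (Gs ! j)"
      using that Suc.prems n by auto
    show ?thesis
      using Suc.prems(5)[OF that] * unfolding cells_Suc_ngph[OF *] by (auto simp: y)
  qed
  have "app z (pair n' (map (\<lambda>F. mhom F a a') Fs)) \<in> cells m (gprod n'
      (map (\<lambda>i. ghom (Gs ! i) (mob (Fs ! i) a) (mob (Fs ! i) a')) [0..<length Gs]))"
    using Suc.prems n y step by (intro Suc.IH) auto
  moreover have "map (\<lambda>i. ghom (Gs ! i) (mob (Fs ! i) a) (mob (Fs ! i) a')) [0..<length Gs] =
      map (\<lambda>i. ghom (Gs ! i) (map (\<lambda>F. mob F a) Fs ! i) (map (\<lambda>F. mob F a') Fs ! i)) [0..<length Gs]"
    using Suc.prems by simp
  ultimately show ?case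
    using step Suc.prems(3) by (auto simp: n y listset_iff)
qed

section \<open>The comparison from \<open>Q\<close> to \<open>T\<close> in terms of the
  decomposition\<close>

lemma app_gcoprod_map:
  "cdim y \<le> n \<Longrightarrow> app (tagcell i y) (gcoprod_map n \<phi> h) = tagcell (\<phi> i) (app y (h i))"
  by (cases n; cases y) auto

text \<open>The components of the comparison between summands: the map from \<open>P_n(k)\<close> to
  the terminal object on the label, and the comparison one level lower on each edge factor.\<close>

definition over_string :: "nat \<Rightarrow> nat \<Rightarrow> 'e mor list" where
  "over_string n k = mcomp n (pair n []) (proj n 0) #
     map (\<lambda>i. mcomp n (q n (gone n)) (proj n i)) [1..<Suc k]"

lemma length_over_string: "length (over_string n k) = Suc k"
  by (simp add: over_string_def)

text \<open>The comparison is the identity on objects, so it preserves the string; inside the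
  summand it acts as the pairing of \<open>over_string\<close>.\<close>

lemma over_Suc:
  fixes y :: "'e elt cell"
  assumes "cdim y \<le> n"
  shows "over (Suc n) (Step a a' (tagcell (const_string k) y)) =
    Step a a' (tagcell (const_string k) (app y (pair n (over_string n k))))"
proof -
  have "string_map n (pair n []) (star_map (q n) (gone (Suc n))) (replicate (Suc k) (Tup [])) =
      (pair n (over_string n k) :: 'e mor)"
    by (simp add: string_map_def star_map_def over_string_def Let_def)
  then show ?thesis
    using assms by (simp add: over_def fc_map_def app_gcoprod_map star_map_def del: replicate_Suc)
qed

lemma over_string_nth:
  assumes "cdim y \<le> n" "j \<le> k"
  shows "app y (over_string n k ! j) = (if j = 0 then app (map_cell (coord 0) y) (pair n [])
    else over n (map_cell (coord j) y))"
  using assms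
  by (auto simp: over_string_def app_mcomp app_proj over_def nth_Cons' simp del: upt_Suc)

lemma app_pair_Nil_cells: "cdim y = m \<Longrightarrow> m \<le> n \<Longrightarrow> app y (pair n []) \<in> cells m (gone n)"
  by (rule app_pair_cells_gprod) auto

lemma cdim_map_cell [simp]: "cdim (map_cell f y) = cdim y"
  by (induction y) auto

lemma over_0: "over n (Pt (Tup [])) = Pt (Tup [])"
  by (cases n) (auto simp: over_def fc_map_def star_map_def)

text \<open>Factor by factor: the label goes to a cell of the terminal object, and each edge factor
  is covered by the induction hypothesis.\<close>

lemma over_in_cells_T:
  assumes "operads_in_gph P" "m \<le> n" "x \<in> cells m (Q P n (gone n))"
  shows "over n x \<in> cells m (T n (gone n))"
  using assms(2,3)
proof (induction m arbitrary: n x)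
  case 0
  then show ?case
    by (metis cells_0_Q over_0 singletonD singletonI)
next
  case (Suc m)
  then obtain n' where n: "n = Suc n'" and m: "m \<le> n'"
    by (cases n) auto
  obtain k y where x: "x = Step (Tup []) (Tup []) (tagcell (const_string k) y)"
    and y: "y \<in> cells m (gprod n' (Q_summand P n' k))"
    using Suc.prems(2) unfolding n cells_Q_Suc[OF assms(1) m] by auto
  have dim: "cdim y = m"
    using y by (rule cdim_cells)
  have "app y (pair n' (over_string n' k)) \<in> cells m (gprod n' (Q_summand terminal_operad n' k))"
  proof (rule app_pair_cells_gprod[OF dim m _ is_ngph_Q_summand[OF terminal_operads_in_gph]])
    fix j assume j: "j < length (Q_summand terminal_operad n' k :: 'a gph list)"
    then have jk: "j \<le> k"
      by (simp add: Q_summand_def)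
    show "app y (over_string n' k ! j) \<in> cells m (Q_summand terminal_operad n' k ! j)"
    proof (cases "j = 0")
      case True
      then show ?thesis
        using dim m jk
        by (simp add: over_string_nth Q_summand_def terminal_operad_def forget_cprod_Nil
            app_pair_Nil_cells)
    next
      case False
      have "map_cell (coord j) y \<in> cells m (Q_summand P n' k ! j)"
        using jk by (intro coord_cells_gprod[OF y _ m is_ngph_Q_summand[OF assms(1)]])
          (simp add: Q_summand_def)
      then have "over n' (map_cell (coord j) y) \<in> cells m (T n' (gone n'))"
        using False jk by (intro Suc.IH m) (simp add: Q_summand_def nth_Cons')
      then show ?thesis
        using False dim m jk by (simp add: over_string_nth Q_summand_def nth_Cons')
    qed
  qed (simp add: over_string_def Q_summand_def)
  then show ?case
    unfolding n x cells_Q_Suc[OF terminal_operads_in_gph m] using over_Suc dim m by blast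
qed

text \<open>A tree is built from string lengths and branches alone. The comparison keeps the former
  and commutes with \<open>branch\<close>.\<close>

lemma tree_of_over:
  assumes "operads_in_gph P" "m \<le> n" "x \<in> cells m (Q P n (gone n))"
  shows "tree_of m (over n x) = tree_of m x"
  using assms(2,3)
proof (induction m arbitrary: n x)
  case (Suc m)
  then obtain n' where n: "n = Suc n'" and m: "m \<le> n'"
    by (cases n) auto
  obtain k y where x: "x = Step (Tup []) (Tup []) (tagcell (const_string k) y)"
    and y: "y \<in> cells m (gprod n' (Q_summand P n' k))"
    using Suc.prems(2) unfolding n cells_Q_Suc[OF assms(1) m] by auto
  have dim: "cdim y = m"
    using y by (rule cdim_cells)
  have over_x: "over n x =
      Step (Tup []) (Tup []) (tagcell (const_string k) (app y (pair n' (over_string n' k))))"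
    unfolding n x by (rule over_Suc) (simp add: dim m)
  have len: "string_length (over n x) = k" "string_length x = k"
    by (simp_all add: over_x) (simp add: x)
  have "tree_of m (branch i (over n x)) = tree_of m (branch i x)" if "i < k" for i
  proof -
    have "branch i (over n x) = over n' (branch i x)"
      using that dim m
      by (simp add: branch_def len over_x coord_app_pair over_string_nth length_over_string)
        (simp add: x)
    moreover have "branch i x \<in> cells m (Q P n' (gone n'))"
      using Suc.prems(2) that len by (intro branch_cells_Q[OF assms(1) m]) (auto simp: n)
    ultimately show ?thesis
      using Suc.IH[OF m] by metis
  qed
  then show ?case
    by (simp add: len)
qed simp


section \<open>Labellings\<close>

text \<open>The equation \<open>trunc m t = t\<close> says that \<open>t\<close> is an m-stage tree;
  this supplies that hypothesis for \<open>bij_betw_labelling\<close>.\<close>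

lemma trunc_tree_of: "trunc m (tree_of m x) = tree_of m x"
  by (induction m arbitrary: x) auto

section \<open>Labels of a tree in terms of its branches, and the labelling bijection\<close>

lemma Nil_in_nodes_below_Suc [simp]: "[] \<in> nodes_below (Suc m) t"
  by (simp add: nodes_below_def)

lemma Cons_in_nodes_below_Suc [simp]:
  "i # p \<in> nodes_below (Suc m) t \<longleftrightarrow> i < length (children t) \<and> p \<in> nodes_below m (children t ! i)"
  by (auto simp: nodes_below_def)

lemma nodes_below_0 [simp]: "nodes_below 0 t = {}"
  by (simp add: nodes_below_def)

text \<open>Removing the base node lowers \<open>m\<close>, \<open>n\<close> and every height by
  one, so the differences that govern the labels, \<open>m - b - 1\<close> and
  \<open>n - b - 1\<close>, are unchanged in the branches.\<close>

lemma labellings_Suc: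
  "f \<in> labellings P (Suc n) (Suc m) t \<longleftrightarrow>
     f \<in> extensional (nodes_below (Suc m) t) \<and>
     f [] \<in> cells m (forget (ar (P n) (length (children t)))) \<and>
     (\<forall>i<length (children t). (\<lambda>p\<in>nodes_below m (children t ! i). f (i # p))
        \<in> labellings P n m (children t ! i))"
  (is "?L \<longleftrightarrow> ?R")
proof
  assume ?L
  then have f: "f p \<in> cells (Suc m - length p - 1) (forget (ar (P (Suc n - length p - 1)) (arity p t)))"
    if "p \<in> nodes_below (Suc m) t" for p
    using that by (auto simp: labellings_def PiE_iff)
  show ?R
    using \<open>?L\<close> f[of "[]"] f[of "_ # _"] by (auto simp: labellings_def PiE_iff)
next
  assume R: ?R
  have "f p \<in> cells (Suc m - length p - 1) (forget (ar (P (Suc n - length p - 1)) (arity p t)))"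
    if "p \<in> nodes_below (Suc m) t" for p
    using that R by (cases p) (auto simp: labellings_def PiE_iff)
  then show ?L
    using R by (auto simp: labellings_def PiE_iff)
qed

lemma labelling_Suc_nth:
  "i < length (children t) \<Longrightarrow>
     (\<lambda>p\<in>nodes_below m (children t ! i). labelling (Suc m) t x (i # p)) =
     labelling m (children t ! i) (branch i x)"
  by (auto simp: labelling_def fun_eq_iff restrict_def)

text \<open>Induction on the dimension: a cell amounts to a base label and branches, the labels of
  the branches are handled inductively, and \<open>labellings_Suc\<close> reassembles them. The
  fibre is described by \<open>tree_of\<close> rather than \<open>over\<close>, a form which
  recurses along branches and also makes sense for \<open>T\<close>.\<close>

lemma bij_betw_labelling:
  assumes "operads_in_gph P" "m \<le> n" "trunc m t = t"
  shows "bij_betw (labelling m t) {x \<in> cells m (Q P n (gone n)). tree_of m x = t} (labellings P n m t)"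
  using assms(2,3)
proof (induction m arbitrary: n t)
  case 0
  \<comment> \<open>No node is labelled here, so both sides are singletons: the unique 0-cell and
    the function that is \<open>undefined\<close> everywhere.\<close>
  then show ?case
    by (auto simp: cells_0_Q labelling_def labellings_def bij_betw_def simp del: cells.simps)
next
  case (Suc m)
  then obtain n' where n: "n = Suc n'" and m: "m \<le> n'"
    by (cases n) auto
  obtain ts where t: "t = Node ts"
    by (cases t)
  let ?k = "length ts"
  let ?C = "\<lambda>i. {x \<in> cells m (Q P n' (gone n')). tree_of m x = ts ! i}"
  let ?D = "{x \<in> cells (Suc m) (Q P n (gone n)). tree_of (Suc m) x = t}"
  \<comment> \<open>The branches of an (m+1)-stage tree are m-stage trees, as the induction
    hypothesis requires.\<close>
  have "trunc m (ts ! i) = ts ! i" if "i < ?k" for i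
    using Suc.prems(2) nth_map[OF that, of "trunc m"] by (simp add: t)
  then have bij: "bij_betw (labelling m (ts ! i)) (?C i) (labellings P n' m (ts ! i))"
    if "i < ?k" for i
    using Suc.IH[OF m] that by blast
  have D: "string_length x = ?k \<and> factor 0 x \<in> cells m (forget (ar (P n') ?k)) \<and>
      (\<forall>i<?k. branch i x \<in> ?C i)" if "x \<in> ?D" for x
  proof -
    have x: "x \<in> cells (Suc m) (Q P (Suc n') (gone (Suc n')))"
      and ts: "ts = map (\<lambda>i. tree_of m (branch i x)) [0..<string_length x]"
      using that by (auto simp: n t)
    have len: "string_length x = ?k"
      by (simp add: ts)
    have "tree_of m (branch i x) = ts ! i" if "i < ?k" for i
      using that by (subst ts) (simp add: len)
    then show ?thesis
      using factor_0_cells_Q[OF assms(1) m x] branch_cells_Q[OF assms(1) m x] len by auto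
  qed
  show ?case
    unfolding bij_betw_def
  proof (intro conjI inj_onI equalityI subsetI)
    fix x x' assume x: "x \<in> ?D" and x': "x' \<in> ?D" and eq: "labelling (Suc m) t x = labelling (Suc m) t x'"
    show "x = x'"
    proof (rule cells_Q_Suc_eqI[OF assms(1) m])
      show "factor 0 x = factor 0 x'"
        \<comment> \<open>The base label is the value of the labelling at the empty path.\<close>
        using fun_cong[OF eq, of "[]"] by (simp add: labelling_def)
      show "branch i x = branch i x'" if "i < string_length x" for i
      proof -
        have i: "i < ?k"
          using D[OF x] that by simp
        have "labelling m (ts ! i) (branch i x) = labelling m (ts ! i) (branch i x')"
          using labelling_Suc_nth[of i t m x] labelling_Suc_nth[of i t m x'] i eq by (simp add: t)
        then show ?thesis
          using bij[OF i] D[OF x] D[OF x'] i by (meson bij_betw_def inj_onD)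
      qed
    qed (use x x' D[OF x] D[OF x'] n in auto)
  next
    fix f assume "f \<in> labelling (Suc m) t ` ?D"
    then obtain x where f: "f = labelling (Suc m) t x" and x: "x \<in> ?D"
      by auto
    show "f \<in> labellings P n (Suc m) t"
      unfolding n labellings_Suc
    proof (intro conjI allI impI)
      show "f \<in> extensional (nodes_below (Suc m) t)"
        by (simp add: f labelling_def)
      show "f [] \<in> cells m (forget (ar (P n') (length (children t))))"
        using D[OF x] by (simp add: f labelling_def t)
      fix i assume i: "i < length (children t)"
      then show "(\<lambda>p\<in>nodes_below m (children t ! i). f (i # p)) \<in> labellings P n' m (children t ! i)"
        unfolding f labelling_Suc_nth[OF i] using D[OF x] bij[of i]
        by (auto simp: t dest: bij_betwE)
    qed
  next
    fix f assume "f \<in> labellings P n (Suc m) t"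
    then have ext: "f \<in> extensional (nodes_below (Suc m) t)"
      and r: "f [] \<in> cells m (forget (ar (P n') ?k))"
      and fi: "\<And>i. i < ?k \<Longrightarrow> (\<lambda>p\<in>nodes_below m (ts ! i). f (i # p)) \<in> labellings P n' m (ts ! i)"
      by (auto simp: n labellings_Suc t)
    \<comment> \<open>The branches of the required cell are the preimages, under the inductive
      bijections, of the labelling \<open>f\<close> cut down to each subtree.\<close>
    define b where
      "b i = inv_into (?C i) (labelling m (ts ! i)) (\<lambda>p\<in>nodes_below m (ts ! i). f (i # p))" for i
    have b: "b i \<in> ?C i \<and> labelling m (ts ! i) (b i) = (\<lambda>p\<in>nodes_below m (ts ! i). f (i # p))"
      if "i < ?k" for i
    proof
      have f: "(\<lambda>p\<in>nodes_below m (ts ! i). f (i # p)) \<in> labelling m (ts ! i) ` ?C i"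
        unfolding bij_betw_imp_surj_on[OF bij[OF that]] by (rule fi[OF that])
      show "b i \<in> ?C i"
        unfolding b_def by (rule inv_into_into[OF f])
      show "labelling m (ts ! i) (b i) = (\<lambda>p\<in>nodes_below m (ts ! i). f (i # p))"
        unfolding b_def by (rule f_inv_into_f[OF f])
    qed
    have "\<exists>x\<in>cells (Suc m) (Q P (Suc n') (gone (Suc n'))).
        string_length x = ?k \<and> factor 0 x = f [] \<and> (\<forall>i<?k. branch i x = b i)"
      using b by (intro cells_Q_Suc_ex[OF assms(1) m r]) auto
    then obtain x where x: "x \<in> cells (Suc m) (Q P n (gone n))"
      and dx: "string_length x = ?k" "factor 0 x = f []" "\<And>i. i < ?k \<Longrightarrow> branch i x = b i"
      unfolding n by blast
    have "tree_of (Suc m) x = t"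
      using dx b by (auto simp: t intro!: nth_equalityI)
    moreover have "labelling (Suc m) t x = f"
    proof (rule extensionalityI[OF _ ext])
      show "labelling (Suc m) t x \<in> extensional (nodes_below (Suc m) t)"
        by (simp add: labelling_def)
      fix p assume p: "p \<in> nodes_below (Suc m) t"
      show "labelling (Suc m) t x p = f p"
      proof (cases p)
        case Nil
        then show ?thesis
          by (simp add: labelling_def dx)
      next
        case (Cons i p')
        then have i: "i < ?k" and p': "p' \<in> nodes_below m (ts ! i)"
          using p by (auto simp: t)
        have "labelling m (ts ! i) (b i) p' = f (i # p')"
          using b[OF i] p' by simp
        then show ?thesis
          using p p' by (simp add: labelling_def Cons dx i)
      qed
    qed
    ultimately show "f \<in> labelling (Suc m) t ` ?D"
      using x by blast
  qed
qed

section \<open>Cells of \<open>T\<close> are determined by their trees\<close>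

lemma cells_gone_unique:
  assumes "x \<in> cells m (gone n)" "y \<in> cells m (gone n)" "m \<le> n"
  shows "x = y"
  using assms by (intro cells_gprod_eqI[of x m n "[]" y]) auto

text \<open>The labelling bijection is applied to the terminal operads. Their labels lie in empty
  products, which have at most one cell in each dimension, so a tree admits at most one labelling
  and hence at most one cell.\<close>

lemma inj_on_tree_of:
  assumes "m \<le> n"
  shows "inj_on (tree_of m) (cells m (T n (gone n)))"
proof (rule inj_onI)
  fix x y :: "'e elt cell"
  assume x: "x \<in> cells m (T n (gone n))" and y: "y \<in> cells m (T n (gone n))"
    and eq: "tree_of m x = tree_of m y"
  let ?t = "tree_of m x"
  have bij: "bij_betw (labelling m ?t) {z \<in> cells m (T n (gone n)). tree_of m z = ?t}
      (labellings terminal_operad n m ?t :: (nat list \<Rightarrow> 'e elt cell) set)"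
    by (rule bij_betw_labelling[OF terminal_operads_in_gph assms trunc_tree_of])
  have "f = g" if "f \<in> labellings terminal_operad n m ?t" "g \<in> labellings terminal_operad n m ?t"
    for f g :: "nat list \<Rightarrow> 'e elt cell"
  proof (rule PiE_ext)
    show "f \<in> (\<Pi>\<^sub>E p\<in>nodes_below m ?t. cells (m - length p - 1) (gone (n - length p - 1)))"
      "g \<in> (\<Pi>\<^sub>E p\<in>nodes_below m ?t. cells (m - length p - 1) (gone (n - length p - 1)))"
      using that by (simp_all add: labellings_def terminal_operad_def forget_cprod_Nil)
    then show "f p = g p" if "p \<in> nodes_below m ?t" for p
      using that assms
      by (intro cells_gone_unique[of _ "m - length p - 1" "n - length p - 1"]) (auto simp: PiE_iff)
  qed
  then have "labelling m ?t x = labelling m ?t y"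
    using bij_betwE[OF bij] x y eq by simp
  then show "x = y"
    using bij x y eq by (auto simp: bij_betw_def dest: inj_onD)
qed

text \<open>Translates lying over a cell of \<open>T\<close> into equality of trees, the form in
  which the labelling bijection is stated.\<close>

lemma over_eq_iff:
  assumes "operads_in_gph P" "m \<le> n" "x \<in> cells m (Q P n (gone n))" "\<alpha> \<in> cells m (T n (gone n))"
  shows "over n x = \<alpha> \<longleftrightarrow> tree_of m x = tree_of m \<alpha>"
  using inj_on_tree_of[OF assms(2)] over_in_cells_T[OF assms(1-3)] assms(4)
    tree_of_over[OF assms(1-3)]
  by (metis inj_onD)


section \<open>Source and target\<close>

text \<open>The variable \<open>bd\<close> stands for either \<open>src\<close> or
  \<open>tgt\<close>, so that each argument about boundaries is given once.\<close>

lemma boundary_in_cells: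
  assumes "bd = src \<or> bd = tgt" "x \<in> cells (Suc m) G"
  shows "bd x \<in> cells m G"
  using assms(2)
proof (induction m arbitrary: x G)
  case 0
  then show ?case
    using assms(1) by (auto split: gph.splits)
next
  case (Suc m)
  then obtain X H a a' y where G: "G = GGph X H" and x: "x = Step a a' y"
    and a: "a \<in> X" "a' \<in> X" and y: "y \<in> cells (Suc m) (H a a')"
    by (cases G) (auto simp del: cells.simps(2) simp: cells.simps(2)[of "Suc m"])
  have "bd x = Step a a' (bd y)"
    using cdim_cells[OF y] assms(1) by (cases y) (auto simp: x)
  then show ?case
    using Suc.IH[OF y] a by (auto simp: G)
qed

text \<open>The condition on \<open>cdim\<close> excludes points, on which \<open>src\<close> and
  \<open>tgt\<close> are unspecified.\<close>

lemma boundary_map_cell: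
  assumes "bd = src \<or> bd = tgt" "cdim y = Suc m"
  shows "bd (map_cell f y) = map_cell f (bd y)"
  using assms(2)
proof (induction y arbitrary: m rule: src.induct)
  case (2 a a' b b' y)
  then show ?case
    using assms(1) by auto
qed (use assms(1) in auto)

lemma boundary_tagcell:
  assumes "bd = src \<or> bd = tgt" "cdim y = Suc m"
  shows "bd (tagcell i y) = tagcell i (bd y)"
  using assms by (cases y rule: src.cases) auto

lemma boundary_Step:
  "bd = src \<or> bd = tgt \<Longrightarrow> cdim y = Suc m \<Longrightarrow> bd (Step a a' y) = Step a a' (bd y)"
  by (cases y) auto

section \<open>Boundaries of trees and labels\<close>

lemma cdim_tagcell [simp]: "cdim (tagcell i y) = cdim y"
  by (cases y) auto

text \<open>From dimension 2 on, the boundary leaves the outermost \<open>Step\<close> in place and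
  acts inside a single summand, hence on each factor separately. In dimension 1 it would be the
  object, and the decomposition would be lost.\<close>

lemma boundary_cells_Q:
  assumes "operads_in_gph P" "Suc m \<le> n" "x \<in> cells (Suc (Suc m)) (Q P (Suc n) (gone (Suc n)))"
    and bd: "bd = src \<or> bd = tgt"
  shows string_length_boundary: "string_length (bd x) = string_length x"
    and factor_boundary: "factor j (bd x) = bd (factor j x)"
proof -
  obtain k y where x: "x = Step (Tup []) (Tup []) (tagcell (const_string k) y)"
    and y: "y \<in> cells (Suc m) (gprod n (Q_summand P n k))"
    using assms(3) unfolding cells_Q_Suc[OF assms(1,2)] by auto
  have dim: "cdim y = Suc m"
    using y by (rule cdim_cells)
  have bdx: "bd x = Step (Tup []) (Tup []) (tagcell (const_string k) (bd y))"
    using dim bd by (simp add: x boundary_Step[where m = m] boundary_tagcell[where m = m] del: replicate_Suc)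
  show "string_length (bd x) = string_length x"
    unfolding bdx unfolding x by simp
  show "factor j (bd x) = bd (factor j x)"
    unfolding bdx unfolding x using boundary_map_cell[OF bd dim] by simp
qed

lemma branch_boundary:
  assumes "operads_in_gph P" "Suc m \<le> n" "x \<in> cells (Suc (Suc m)) (Q P (Suc n) (gone (Suc n)))"
    and "bd = src \<or> bd = tgt"
  shows "branch i (bd x) = bd (branch i x)"
  by (simp add: branch_def string_length_boundary[OF assms] factor_boundary[OF assms])

text \<open>The boundary is pushed into the branches until dimension 1 is reached, where the tree of
  the resulting 0-cell is a single node.\<close>

lemma tree_of_boundary:
  assumes "operads_in_gph P" "m < n" "x \<in> cells (Suc m) (Q P n (gone n))"
    and bd: "bd = src \<or> bd = tgt"
  shows "tree_of m (bd x) = trunc m (tree_of (Suc m) x)"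
  using assms(2,3)
proof (induction m arbitrary: n x)
  case (Suc m)
  then obtain n' where n: "n = Suc n'" and m: "Suc m \<le> n'"
    by (cases n) auto
  have x: "x \<in> cells (Suc (Suc m)) (Q P (Suc n') (gone (Suc n')))"
    using Suc.prems n by simp
  have "tree_of m (branch i (bd x)) = trunc m (tree_of (Suc m) (branch i x))"
    if "i < string_length x" for i
    using Suc.IH[of n' "branch i x"] m branch_cells_Q[OF assms(1) m x that]
    by (simp add: branch_boundary[OF assms(1) m x bd])
  then show ?case
    using string_length_boundary[OF assms(1) m x bd]
    by (simp add: tree_of.simps(2)[of "Suc m"] tree_of.simps(2)[of m] del: tree_of.simps(2))
qed simp

lemma node_label_boundary:
  assumes "operads_in_gph P" "m < n" "x \<in> cells (Suc m) (Q P n (gone n))"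
    and bd: "bd = src \<or> bd = tgt" and "p \<in> nodes_below m (tree_of (Suc m) x)"
  shows "node_label p (bd x) = bd (node_label p x)"
  using assms(2,3,5)
proof (induction p arbitrary: m n x)
  case Nil
  \<comment> \<open>The base node lies below height \<open>m\<close>, so \<open>m\<close> is
    positive and \<open>x\<close> has dimension at least 2.\<close>
  then obtain m' n' where mn: "m = Suc m'" "n = Suc n'" "Suc m' \<le> n'"
    by (cases m; cases n) auto
  then show ?case
    using Nil.prems(2) factor_boundary[OF assms(1) _ _ bd, of m' n' x 0] by simp
next
  case (Cons i p)
  then obtain m' n' where mn: "m = Suc m'" "n = Suc n'" "Suc m' \<le> n'"
    by (cases m; cases n) auto
  have x: "x \<in> cells (Suc (Suc m')) (Q P (Suc n') (gone (Suc n')))"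
    using Cons.prems mn by simp
  have i: "i < string_length x" and p: "p \<in> nodes_below m' (tree_of (Suc m') (branch i x))"
    using Cons.prems(3) by (auto simp: mn tree_of.simps(2)[of "Suc m'"] simp del: tree_of.simps(2))
  show ?case
    using Cons.IH[OF _ branch_cells_Q[OF assms(1) mn(3) x i] p] mn
    by (simp add: branch_boundary[OF assms(1) mn(3) x bd])
qed

text \<open>Truncation at \<open>m\<close> deletes only nodes above height \<open>m\<close>, whereas
  the labelled nodes have height less than \<open>m\<close>.\<close>

lemma nodes_below_trunc: "nodes_below m (trunc m t) = nodes_below m t"
proof -
  have "p \<in> nodes_below m (trunc m t) \<longleftrightarrow> p \<in> nodes_below m t" for p
  proof (induction p arbitrary: m t)
    case Nil
    then show ?case by (simp add: nodes_below_def)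
  next
    case (Cons i p)
    then show ?case by (cases m) auto
  qed
  then show ?thesis by blast
qed

lemma nodes_below_mono: "m \<le> n \<Longrightarrow> nodes_below m t \<subseteq> nodes_below n t"
  by (auto simp: nodes_below_def)

lemma boundary_Q:
  assumes "operads_in_gph P" "m < n" "x \<in> cells (Suc m) (Q P n (gone n))"
    and bd: "bd = src \<or> bd = tgt"
  defines "t \<equiv> tree_of (Suc m) x"
  shows "bd x \<in> cells m (Q P n (gone n))"
    and "tree_of m (over n (bd x)) = trunc m t"
    and "labelling m (trunc m t) (bd x) = (\<lambda>p\<in>nodes_below m (trunc m t). bd (labelling (Suc m) t x p))"
proof -
  show bdx: "bd x \<in> cells m (Q P n (gone n))"
    by (rule boundary_in_cells[OF bd assms(3)])
  show "tree_of m (over n (bd x)) = trunc m t"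
    using assms(2) tree_of_over[OF assms(1) _ bdx] tree_of_boundary[OF assms(1-3) bd]
    by (simp add: t_def)
  \<comment> \<open>A node that keeps a label after truncation was already labelled, so the old
    labelling has there its true value and not the default of \<open>restrict\<close>.\<close>
  have "nodes_below m t \<subseteq> nodes_below (Suc m) t"
    by (rule nodes_below_mono) simp
  then show "labelling m (trunc m t) (bd x) =
      (\<lambda>p\<in>nodes_below m (trunc m t). bd (labelling (Suc m) t x p))"
    unfolding labelling_def nodes_below_trunc
    using node_label_boundary[OF assms(1-3) bd] by (auto simp: t_def restrict_def fun_eq_iff)
qed


theorem proposition4p6:
  fixes P :: "nat \<Rightarrow> 'e operad" and n :: nat
  assumes "iterative_theory P" and "n > 0"
  shows
    "(\<forall>m\<le>n. \<forall>\<alpha>\<in>cells m (T n (gone n)).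
        bij_betw (labelling m (tree_of m \<alpha>))
          {x \<in> cells m (Q P n (gone n)). over n x = \<alpha>}
          (labellings P n m (tree_of m \<alpha>))) \<and>
     (\<forall>m<n. \<forall>\<alpha>\<in>cells (Suc m) (T n (gone n)).
        \<forall>x\<in>cells (Suc m) (Q P n (gone n)). over n x = \<alpha> \<longrightarrow>
          (let t = tree_of (Suc m) \<alpha>; t' = trunc m t in
             src x \<in> cells m (Q P n (gone n)) \<and>
             tree_of m (over n (src x)) = t' \<and>
             labelling m t' (src x) =
               (\<lambda>p\<in>nodes_below m t'. src (labelling (Suc m) t x p)) \<and>
             tgt x \<in> cells m (Q P n (gone n)) \<and>
             tree_of m (over n (tgt x)) = t' \<and>
             labelling m t' (tgt x) =
               (\<lambda>p\<in>nodes_below m t'. tgt (labelling (Suc m) t x p))))"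
proof -
  have P: "operads_in_gph P"
    using assms(1) by (rule iterative_theory_operads_in_gph)
  have "bij_betw (labelling m (tree_of m \<alpha>)) {x \<in> cells m (Q P n (gone n)). over n x = \<alpha>}
      (labellings P n m (tree_of m \<alpha>))"
    if "m \<le> n" "\<alpha> \<in> cells m (T n (gone n))" for m \<alpha>
  proof -
    \<comment> \<open>The fibre over \<alpha> is replaced by the fibre over the tree of \<alpha>, to
      which the labelling bijection applies.\<close>
    have "{x \<in> cells m (Q P n (gone n)). over n x = \<alpha>} =
        {x \<in> cells m (Q P n (gone n)). tree_of m x = tree_of m \<alpha>}"
      using over_eq_iff[OF P that(1) _ that(2)] by blast
    then show ?thesis
      using bij_betw_labelling[OF P that(1) trunc_tree_of] by simp
  qed
  moreover have "let t = tree_of (Suc m) \<alpha>; t' = trunc m t in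
      src x \<in> cells m (Q P n (gone n)) \<and>
      tree_of m (over n (src x)) = t' \<and>
      labelling m t' (src x) = (\<lambda>p\<in>nodes_below m t'. src (labelling (Suc m) t x p)) \<and>
      tgt x \<in> cells m (Q P n (gone n)) \<and>
      tree_of m (over n (tgt x)) = t' \<and>
      labelling m t' (tgt x) = (\<lambda>p\<in>nodes_below m t'. tgt (labelling (Suc m) t x p))"
    if "m < n" "x \<in> cells (Suc m) (Q P n (gone n))" "over n x = \<alpha>" for m \<alpha> x
  proof -
    have tree: "tree_of (Suc m) \<alpha> = tree_of (Suc m) x"
      using that by (metis Suc_leI tree_of_over[OF P])
    show ?thesis
      unfolding Let_def tree
      by (intro conjI boundary_Q[OF P that(1,2)]) simp_all
  qed
  ultimately show ?thesis
    by (intro conjI allI impI ballI)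
qed

end
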